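(* Let $\mathcal I=(1,m,n,\mathcal X,\mathcal X^{(S)},R)$ be an instance of the ICCSI problem over $\mathbb F_q$ (with $t=1$), let $\delta\ge0$ be an integer and $N$ a positive integer. Let $L\in\mathbb F_q^{N\times d_S}$ be selected uniformly at random. The probability that $L$ represents an $\mathbb F_q$-linear Hamming metric $(\mathcal I,\delta)$-ECIC is at least $$1-\sum_{i=1}^mq^{n-d_i-1}(q-1)\frac{V_q(N,2\delta)}{q^N}.$$ In particular, there exists an $\mathbb F_q$-linear $(\mathcal I,\delta)$-ECIC of length $N$ if $$N>n-d-1+\log_q\bigl(m(q-1)V_q(N,2\delta)\bigr),$$ where $d=\min\{d_i:i\in[m]\}$.
   Context: Notation: $q$ is a prime power, $\mathbb F_q$ the field with $q$ elements, $[m]=\{1,\dots,m\}$. For a matrix $A$, $A_i$ is its $i$-th row and $\langle A\rangle$ its row space. $w$ is the Hamming weight (number of nonzero entries) of a vector. $V_q(N,r)$ is the number of vectors in $\mathbb F_q^N$ of Hamming weight at most $r$. Instance (with $t=1$): positive integers $m,n$; subspaces $\mathcal X^{(S)}$ and $\mathcal X^{(i)}$ ($i\in[m]$) of $\mathbb F_q^n$ of dimensions $d_S$ and $d_i$; $\mathcal X=\{A\in\mathbb F_q^{m\times n}:A_i\in\mathcal X^{(i)}\}$; a matrix $R\in\mathbb F_q^{m\times n}$ with rows $R_i\in\mathcal X^{(S)}\setminus\mathcal X^{(i)}$. Fix $V^{(S)}\in\mathbb F_q^{d_S\times n}$, $V^{(i)}\in\mathbb F_q^{d_i\times n}$ with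 $\langle V^{(S)}\rangle=\mathcal X^{(S)}$, $\langle V^{(i)}\rangle=\mathcal X^{(i)}$. Error-correcting index codes: $L\in\mathbb F_q^{N\times d_S}$ represents an $\mathbb F_q$-linear (Hamming metric) $(\mathcal I,\delta)$-ECIC of length $N$ if for each $i\in[m]$ there is a map $D_i:\mathbb F_q^N\times\mathbb F_q^{d_i}\to\mathbb F_q$ with $D_i(LV^{(S)}X+W,V^{(i)}X)=R_iX$ for all $X\in\mathbb F_q^n$ and all $W\in\mathbb F_q^N$ with $w(W)\le\delta$. *)

theory Defs
  imports "HOL-Probability.Probability" "Jordan_Normal_Form.VS_Connect"
begin

text \<open>
  The field with \<open>q\<close> elements is a type \<open>'a :: {field, finite}\<close> with \<open>q = CARD('a)\<close>.
  The index set \<open>[m]\<close> is rendered as \<open>{0..<m}\<close>, matching the 0-based row indices of matrices.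
\<close>

definition hamming_weight :: "'a::zero vec \<Rightarrow> nat" where
  "hamming_weight v = card {i. i < dim_vec v \<and> v $ i \<noteq> 0}"

definition hamming_ball_card :: "'a::zero itself \<Rightarrow> nat \<Rightarrow> nat \<Rightarrow> nat" where
  "hamming_ball_card _ N r = card {v \<in> (carrier_vec N :: 'a vec set). hamming_weight v \<le> r}"

definition is_subspace_of_dim :: "nat \<Rightarrow> 'a::field vec set \<Rightarrow> nat \<Rightarrow> bool" where
  "is_subspace_of_dim n W k \<longleftrightarrow>
     VectorSpace.subspace class_ring W (module_vec TYPE('a) n) \<and>
     vectorspace.dim class_ring ((module_vec TYPE('a) n)\<lparr>carrier := W\<rparr>) = k"

text \<open>
  ICCSI instances with \<open>t = 1\<close>. The component \<open>{A. \<forall>i. row A i \<in> X i}\<close> of the instance is given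
  through the family \<open>X\<close>, which it determines and is determined by.
\<close>

definition iccsi_instance ::
  "nat \<Rightarrow> nat \<Rightarrow> (nat \<Rightarrow> 'a::field vec set) \<Rightarrow> (nat \<Rightarrow> nat) \<Rightarrow> 'a vec set \<Rightarrow> nat \<Rightarrow> 'a mat \<Rightarrow> bool"
  where
  "iccsi_instance m n X d XS dS R \<longleftrightarrow>
     0 < m \<and> 0 < n \<and>
     is_subspace_of_dim n XS dS \<and>
     (\<forall>i<m. is_subspace_of_dim n (X i) (d i)) \<and>
     R \<in> carrier_mat m n \<and>
     (\<forall>i<m. row R i \<in> XS - X i)"

definition generator_matrix :: "nat \<Rightarrow> 'a::field vec set \<Rightarrow> nat \<Rightarrow> 'a mat \<Rightarrow> bool" where
  "generator_matrix n W k G \<longleftrightarrow> G \<in> carrier_mat k n \<and> vec_space.row_space n G = W"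

text \<open>
  The decoders are total on \<open>'a vec \<times> 'a vec\<close>, but only their values on vectors of
  lengths \<open>N\<close> and \<open>d i\<close> are constrained.
\<close>

definition represents_ecic ::
  "nat \<Rightarrow> nat \<Rightarrow> nat \<Rightarrow> 'a::field mat \<Rightarrow> nat \<Rightarrow> (nat \<Rightarrow> 'a mat) \<Rightarrow> 'a mat \<Rightarrow> nat \<Rightarrow> 'a mat \<Rightarrow> bool"
  where
  "represents_ecic m n dS VS \<delta> V R N L \<longleftrightarrow>
     L \<in> carrier_mat N dS \<and>
     (\<forall>i<m. \<exists>D :: 'a vec \<times> 'a vec \<Rightarrow> 'a.
        \<forall>X \<in> carrier_vec n. \<forall>W \<in> carrier_vec N. hamming_weight W \<le> \<delta> \<longrightarrow>
          D (L * VS *\<^sub>v X + W, V i *\<^sub>v X) = row R i \<bullet> X)"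

end

theory Submission
  imports Defs "Berlekamp_Zassenhaus.Berlekamp_Type_Based"
begin

text \<open>
  Decoding for receiver \<open>i\<close> works as soon as \<open>L V\<^sup>S z\<close> has weight above \<open>2\<delta>\<close> for every \<open>z\<close> with
  \<open>V\<^sup>i z = 0\<close> and \<open>R\<^sub>i z \<noteq> 0\<close>. There are at most \<open>q^(n - d\<^sub>i - 1) (q - 1)\<close> such \<open>z\<close>, and for each of
  them \<open>V\<^sup>S z \<noteq> 0\<close> because \<open>R\<^sub>i\<close> lies in the row space of \<open>V\<^sup>S\<close>, so \<open>L V\<^sup>S z\<close> is uniformly
  distributed; the union bound gives the probability estimate.
\<close>

unbundle no inner_syntax and no vec_syntax

section \<open>Cardinalities of subspaces and of kernels of functionals\<close>

text \<open>A finite carrier is a finite generating set of itself, so a finite basis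
  \<open>B\<close> exists, and coordinates with respect to \<open>B\<close> put vectors in bijection
  with functions from \<open>B\<close> to the field.\<close>

lemma (in vectorspace) card_carrier_eq_power_dim:
  assumes "finite (carrier V)"
  shows "card (carrier V) = card (carrier K) ^ dim"
proof -
  have "gen_set (carrier V)"
    using in_own_span[of "carrier V"] span_is_subset2[of "carrier V"] by blast
  then have fd: fin_dim
    unfolding fin_dim_def using assms by blast
  obtain B where B: "finite B" "basis B"
    using finite_basis_exists[OF fd] by blast
  then have BV: "B \<subseteq> carrier V"
    by (simp add: basis_def)
  have "\<forall>v\<in>carrier V. \<exists>!a. a \<in> B \<rightarrow>\<^sub>E carrier K \<and> lincomb a B = v"
    using basis_criterion[OF B(1) BV] B(2) by auto
  moreover have "lincomb a B \<in> carrier V" if "a \<in> B \<rightarrow>\<^sub>E carrier K" for a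
    using that BV by (auto simp: PiE_def)
  ultimately have "bij_betw (\<lambda>a. lincomb a B) (B \<rightarrow>\<^sub>E carrier K) (carrier V)"
    unfolding bij_betw_def inj_on_def image_def by (auto 0 4)
  then have "card (carrier V) = card (B \<rightarrow>\<^sub>E carrier K)"
    by (simp add: bij_betw_same_card)
  also have "\<dots> = card (carrier K) ^ dim"
    using B by (simp add: card_PiE dim_basis)
  finally show ?thesis .
qed

lemma one_less_card_UNIV: "1 < CARD('a::{zero_neq_one,finite})"
  using card_mono[of UNIV "{0::'a, 1}"] by simp

lemma card_subspace_of_dim:
  fixes W :: "'a::{field,finite} vec set"
  assumes "is_subspace_of_dim n W k"
  shows "card W = CARD('a) ^ k"
proof -
  interpret vec_space "TYPE('a)" n .
  have sub: "VectorSpace.subspace class_ring W V"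
    and dim: "vectorspace.dim class_ring (V\<lparr>carrier := W\<rparr>) = k"
    using assms by (auto simp: is_subspace_of_dim_def)
  interpret W: vectorspace class_ring "V\<lparr>carrier := W\<rparr>"
    using subspace_is_vs[OF sub] by simp
  have "W \<subseteq> carrier_vec n"
    using sub by (auto simp: VectorSpace.subspace_def submodule_def module_vec_def)
  then have "finite W"
    using finite_carrier_vec finite_subset by blast
  then show ?thesis
    using W.card_carrier_eq_power_dim dim by simp
qed

text \<open>On \<open>A\<close> the functional \<open>u \<bullet> a\<close> takes each field value
  equally often, because its level sets are translates of one another by multiples of a vector in
  \<open>A\<close>. Closure of \<open>A\<close> is assumed directly, so that subspaces, the whole
  space and annihilators are all covered.\<close>

lemma card_kernel_of_functional:
  fixes A :: "'a::{field,finite} vec set"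
  assumes A: "A \<subseteq> carrier_vec n" and u: "u \<in> carrier_vec n"
    and add: "\<And>a b. a \<in> A \<Longrightarrow> b \<in> A \<Longrightarrow> a + b \<in> A"
    and smult: "\<And>a c. a \<in> A \<Longrightarrow> c \<cdot>\<^sub>v a \<in> A"
    and nz: "\<exists>a\<in>A. u \<bullet> a \<noteq> 0"
  shows "CARD('a) * card {a \<in> A. u \<bullet> a = 0} = card A"
proof -
  obtain a\<^sub>0 where a\<^sub>0: "a\<^sub>0 \<in> A" "u \<bullet> a\<^sub>0 \<noteq> 0" using nz by blast
  \<comment> \<open>The rescaling gives \<open>u \<bullet> s = 1\<close>, so the coefficient of
    \<open>s\<close> in \<open>a + c \<cdot>\<^sub>v s\<close> can be read off as the value of the
    functional when \<open>a\<close> lies in the kernel.\<close>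
  define s where "s = (1 / (u \<bullet> a\<^sub>0)) \<cdot>\<^sub>v a\<^sub>0"
  have s: "s \<in> A" "s \<in> carrier_vec n" "u \<bullet> s = 1"
    using a\<^sub>0 A smult[OF a\<^sub>0(1)] u by (auto simp: s_def)
  have ip: "u \<bullet> (a + c \<cdot>\<^sub>v s) = u \<bullet> a + c" if "a \<in> A" for a c
    using that A u s by (subst scalar_prod_add_distrib[of _ n]) auto
  have "bij_betw (\<lambda>(c, a). a + c \<cdot>\<^sub>v s) (UNIV \<times> {a \<in> A. u \<bullet> a = 0}) A"
  proof (rule bij_betw_byWitness[where f' = "\<lambda>a. (u \<bullet> a, a + (- (u \<bullet> a)) \<cdot>\<^sub>v s)"])
    show "\<forall>p\<in>UNIV \<times> {a \<in> A. u \<bullet> a = 0}.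
        (\<lambda>a. (u \<bullet> a, a + (- (u \<bullet> a)) \<cdot>\<^sub>v s)) ((\<lambda>(c, a). a + c \<cdot>\<^sub>v s) p) = p"
    proof clarsimp
      fix c a assume a: "a \<in> A" "u \<bullet> a = 0"
      then have [simp]: "u \<bullet> (a + c \<cdot>\<^sub>v s) = c" by (simp add: ip)
      have "dim_vec a = n" "dim_vec s = n" using a A s by auto
      then show "u \<bullet> (a + c \<cdot>\<^sub>v s) = c \<and>
          a + c \<cdot>\<^sub>v s + - (u \<bullet> (a + c \<cdot>\<^sub>v s)) \<cdot>\<^sub>v s = a"
        by (auto intro!: eq_vecI)
    qed
    show "\<forall>a\<in>A. (\<lambda>(c, a). a + c \<cdot>\<^sub>v s) (u \<bullet> a, a + - (u \<bullet> a) \<cdot>\<^sub>v s) = a"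
    proof
      fix a assume "a \<in> A"
      then have "dim_vec a = n" "dim_vec s = n" using A s by auto
      then show "(\<lambda>(c, a). a + c \<cdot>\<^sub>v s) (u \<bullet> a, a + - (u \<bullet> a) \<cdot>\<^sub>v s) = a"
        by (auto intro!: eq_vecI)
    qed
    show "(\<lambda>(c, a). a + c \<cdot>\<^sub>v s) ` (UNIV \<times> {a \<in> A. u \<bullet> a = 0}) \<subseteq> A"
      using add smult s by auto
    show "(\<lambda>a. (u \<bullet> a, a + - (u \<bullet> a) \<cdot>\<^sub>v s)) ` A \<subseteq> UNIV \<times> {a \<in> A. u \<bullet> a = 0}"
      using add smult s ip by auto
  qed
  from bij_betw_same_card[OF this] show ?thesis
    by (simp add: card_cartesian_product)
qed

section \<open>Size of the orthogonal complement of a subspace\<close>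

text \<open>The orthogonal complement for the bilinear dot product; over a finite field it may meet
  \<open>W\<close> nontrivially. For the row space of \<open>V i\<close> it contains the kernel of
  \<open>V i\<close>, that is, the differences of messages with equal side information.\<close>

definition annihilator :: "nat \<Rightarrow> 'a::comm_ring_1 vec set \<Rightarrow> 'a vec set" where
  "annihilator n W = {z \<in> carrier_vec n. \<forall>w\<in>W. w \<bullet> z = 0}"

lemma annihilator_add:
  assumes "W \<subseteq> carrier_vec n" "a \<in> annihilator n W" "b \<in> annihilator n W"
  shows "a + b \<in> annihilator n W"
  using assms unfolding annihilator_def by (auto simp: scalar_prod_add_distrib[of _ n])

lemma annihilator_smult:
  assumes "W \<subseteq> carrier_vec n" "a \<in> annihilator n W"
  shows "c \<cdot>\<^sub>v a \<in> annihilator n W"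
proof -
  have "w \<bullet> (c \<cdot>\<^sub>v a) = 0" if "w \<in> W" for w
    using assms that scalar_prod_smult_distrib[of w n a c] by (auto simp: annihilator_def)
  then show ?thesis using assms by (auto simp: annihilator_def)
qed

text \<open>Count the pairs \<open>(w, z)\<close> with \<open>w \<in> W\<close> and \<open>w \<bullet> z = 0\<close> in two ways: a fixed \<open>z\<close>
  outside the annihilator, like a fixed \<open>w \<noteq> 0\<close>, is orthogonal to a proportion \<open>1/q\<close> of the
  other side.\<close>

lemma card_mult_card_annihilator:
  fixes W :: "'a::{field,finite} vec set"
  assumes W: "W \<subseteq> carrier_vec n"
    and add: "\<And>a b. a \<in> W \<Longrightarrow> b \<in> W \<Longrightarrow> a + b \<in> W"
    and smult: "\<And>a c. a \<in> W \<Longrightarrow> c \<cdot>\<^sub>v a \<in> W"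
    and zero: "0\<^sub>v n \<in> W"
  shows "card W * card (annihilator n W) = CARD('a) ^ n"
proof -
  let ?q = "real CARD('a)" and ?F = "carrier_vec n :: 'a vec set"
  let ?P = "annihilator n W"
  have q: "?q > 1"
    using one_less_card_UNIV[where 'a = 'a] by simp
  have fF: "finite ?F" and fW: "finite W" using W finite_subset finite_carrier_vec by blast+
  have PF: "?P \<subseteq> ?F" by (auto simp: annihilator_def)
  then have fP: "finite ?P" using fF finite_subset by blast
  have cF: "card ?F = CARD('a) ^ n" by (rule card_carrier_vec)
  define pairs where "pairs = (\<lambda>w z. if w \<bullet> z = (0::'a) then 1 else 0 :: real)"
  have inP: "(\<Sum>w\<in>W. pairs w z) = card W" if "z \<in> ?P" for z
    using that by (simp add: annihilator_def pairs_def)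
  have notP: "(\<Sum>w\<in>W. pairs w z) = card W / ?q" if z: "z \<in> ?F - ?P" for z
  proof -
    obtain w where "w \<in> W" "w \<bullet> z \<noteq> 0" using z by (auto simp: annihilator_def)
    \<comment> \<open>The roles are exchanged here: \<open>z\<close> is the fixed functional and
      \<open>w\<close> varies, so the product is commuted to fit
      \<open>card_kernel_of_functional\<close>.\<close>
    then have "z \<bullet> w \<noteq> 0"
      using z W comm_scalar_prod[of z n w] by auto
    then have "\<exists>w\<in>W. z \<bullet> w \<noteq> 0"
      using \<open>w \<in> W\<close> by blast
    then have "CARD('a) * card {w \<in> W. z \<bullet> w = 0} = card W"
      using card_kernel_of_functional[OF W _ add smult] that by auto
    moreover have "{w \<in> W. z \<bullet> w = 0} = {w \<in> W. w \<bullet> z = 0}"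
      using that W comm_scalar_prod[of z n] by fastforce
    ultimately have "?q * card {w \<in> W. w \<bullet> z = 0} = card W"
      by (metis of_nat_mult)
    then show ?thesis
      using fW q by (simp add: pairs_def sum.If_cases Int_def field_simps)
  qed
  have nonzero: "(\<Sum>z\<in>?F. pairs w z) = ?q ^ n / ?q" if w: "w \<in> W - {0\<^sub>v n}" for w
  proof -
    obtain i where i: "i < n" "w $ i \<noteq> 0"
      using w W by (metis DiffE carrier_vecD eq_vecI index_zero_vec singletonI subsetD)
    then have "\<exists>z\<in>?F. w \<bullet> z \<noteq> 0"
      using that W by (intro bexI[of _ "unit_vec n i"]) auto
    then have "CARD('a) * card {z \<in> ?F. w \<bullet> z = 0} = card ?F"
      using that W by (intro card_kernel_of_functional) auto
    then have "?q * card {z \<in> ?F. w \<bullet> z = 0} = ?q ^ n"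
      unfolding cF by (metis of_nat_mult of_nat_power)
    then show ?thesis
      using fF q by (simp add: pairs_def sum.If_cases Int_def field_simps)
  qed
  have atzero: "(\<Sum>z\<in>?F. pairs (0\<^sub>v n) z) = ?q ^ n"
    by (simp add: pairs_def cF)
  \<comment> \<open>This bound and the next turn truncated subtractions of cardinalities into real
    subtractions.\<close>
  have cW: "card W \<ge> 1" using zero fW by (metis One_nat_def Suc_leI card_gt_0_iff empty_iff)
  have cP: "card ?P \<le> card ?F" using PF fF by (rule card_mono[rotated])
  define w p f where "w = real (card W)" and "p = real (card ?P)" and "f = ?q ^ n"
  have "(\<Sum>z\<in>?F. \<Sum>w\<in>W. pairs w z) = real (card (?F - ?P)) * (w / ?q) + p * w"
    using inP notP by (subst sum.subset_diff[OF PF fF]) (simp add: w_def p_def)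
  also have "real (card (?F - ?P)) = f - p"
    using fP PF cP cF by (simp add: card_Diff_subset of_nat_diff f_def p_def)
  finally have "(\<Sum>z\<in>?F. \<Sum>w\<in>W. pairs w z) = (f - p) * (w / ?q) + p * w" .
  moreover have "(\<Sum>w\<in>W. \<Sum>z\<in>?F. pairs w z) = f + real (card (W - {0\<^sub>v n})) * (f / ?q)"
    using nonzero atzero by (subst sum.remove[OF fW zero]) (simp add: f_def)
  moreover have "real (card (W - {0\<^sub>v n})) = w - 1"
    using fW zero cW by (simp add: of_nat_diff w_def)
  moreover have "(\<Sum>z\<in>?F. \<Sum>w\<in>W. pairs w z) = (\<Sum>w\<in>W. \<Sum>z\<in>?F. pairs w z)"
    by (rule sum.swap)
  ultimately have "(f - p) * (w / ?q) + p * w = f + (w - 1) * (f / ?q)"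
    by metis
  then have "(f - p) * w + p * w * ?q = f * ?q + (w - 1) * f"
    using q by (simp add: field_simps)
  \<comment> \<open>The terms \<open>f * w\<close> on the two sides of the double count cancel,
    leaving the common factor \<open>?q - 1\<close>, which is nonzero.\<close>
  then have "(w * p - f) * (?q - 1) = 0"
    by (simp add: algebra_simps)
  then have "(real (card W * card ?P) - ?q ^ n) * (?q - 1) = 0"
    by (simp add: w_def p_def f_def)
  then have "real (card W * card ?P) = ?q ^ n" using q by simp
  then show ?thesis by (metis of_nat_eq_iff of_nat_power)
qed

text \<open>The annihilator has \<open>q^(n - k)\<close> elements. Either \<open>r\<close> vanishes
  on it, or \<open>r\<close> is nonzero on exactly a proportion \<open>(q - 1)/q\<close> of it; the
  first case is why only an inequality holds. The exponent is an integer because it equals -1 for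
  \<open>k = n\<close>.\<close>

lemma card_annihilator_nonorthogonal_le:
  fixes W :: "'a::{field,finite} vec set"
  assumes W: "is_subspace_of_dim n W k" and r: "r \<in> carrier_vec n"
  shows "real (card {z \<in> annihilator n W. r \<bullet> z \<noteq> 0})
    \<le> real CARD('a) powi (int n - int k - 1) * (real CARD('a) - 1)"
proof -
  let ?q = "real CARD('a)" and ?P = "annihilator n W"
  have q: "?q > 1"
    using one_less_card_UNIV[where 'a = 'a] by simp
  interpret vec_space "TYPE('a)" n .
  have sub: "submodule class_ring W V"
    using W by (auto simp: is_subspace_of_dim_def VectorSpace.subspace_def)
  have WF: "W \<subseteq> carrier_vec n" 
    using submodule.subset[OF sub] by simp
  have "card W * card ?P = CARD('a) ^ n"
    using submodule.m_closed[OF sub] submodule.smult_closed[OF sub] submodule.zero_closed[OF sub]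
    by (intro card_mult_card_annihilator WF) (auto simp: module_vec_def)
  then have "?q ^ k * card ?P = ?q ^ n"
    unfolding card_subspace_of_dim[OF W] by (metis of_nat_mult of_nat_power)
  then have cP: "card ?P = ?q powi (int n - int k)"
    using q by (simp add: power_int_diff field_simps)
  have fP: "finite ?P"
    by (rule finite_subset[OF _ finite_carrier_vec[of n]]) (auto simp: annihilator_def)
  show ?thesis
  proof (cases "\<exists>z\<in>?P. r \<bullet> z \<noteq> 0")
    case True
    then have "CARD('a) * card {z \<in> ?P. r \<bullet> z = 0} = card ?P"
      using annihilator_add[OF WF] annihilator_smult[OF WF] r
      by (intro card_kernel_of_functional) (auto simp: annihilator_def)
    then have ker: "?q * card {z \<in> ?P. r \<bullet> z = 0} = card ?P" by (metis of_nat_mult)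
    have "?P = {z \<in> ?P. r \<bullet> z = 0} \<union> {z \<in> ?P. r \<bullet> z \<noteq> 0}" by auto
    then have "card ?P = card {z \<in> ?P. r \<bullet> z = 0} + card {z \<in> ?P. r \<bullet> z \<noteq> 0}"
      using fP by (metis (no_types, lifting) card_Un_disjoint disjoint_iff finite_Un mem_Collect_eq)
    then have "real (card {z \<in> ?P. r \<bullet> z \<noteq> 0}) = card ?P / ?q * (?q - 1)"
      using ker q by (simp add: field_simps)
    also have "card ?P / ?q = ?q powi (int n - int k - 1)"
      using q unfolding cP by (subst power_int_diff) auto
    finally show ?thesis by simp
  next
    case False
    then have empty: "{z \<in> ?P. r \<bullet> z \<noteq> 0} = {}" by auto
    show ?thesis unfolding empty using q by simp
  qed
qed

section \<open>Uniform distribution of the image of a fixed nonzero vector\<close>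

lemma finite_carrier_mat: "finite (carrier_mat N k :: 'a::finite mat set)"
proof (rule finite_subset)
  let ?I = "{..<N} \<times> {..<k}"
  show "finite (mat N k ` (?I \<rightarrow>\<^sub>E (UNIV :: 'a set)))"
    by (intro finite_imageI finite_PiE) auto
  show "carrier_mat N k \<subseteq> mat N k ` (?I \<rightarrow>\<^sub>E (UNIV :: 'a set))"
  proof
    fix L :: "'a mat" assume "L \<in> carrier_mat N k"
    then have L: "L = mat N k (restrict (($$) L) ?I)" by auto
    show "L \<in> mat N k ` (?I \<rightarrow>\<^sub>E (UNIV :: 'a set))"
      by (rule image_eqI[of _ "mat N k" "restrict (($$) L) ?I", OF L]) simp
  qed
qed

text \<open>The map sending \<open>L\<close> to \<open>L *\<^sub>v u\<close> is linear and onto, so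
  all its fibres are translates of one kernel: for uniform \<open>L\<close> the image is uniform.
  The identity is cross-multiplied to avoid division.\<close>

lemma card_matrices_mapping_into:
  fixes u :: "'a::{field,finite} vec"
  assumes u: "u \<in> carrier_vec k" "u \<noteq> 0\<^sub>v k" and S: "S \<subseteq> carrier_vec N"
  shows "card {L \<in> carrier_mat N k. L *\<^sub>v u \<in> S} * CARD('a) ^ N
    = card S * card (carrier_mat N k :: 'a mat set)"
proof -
  obtain j where j: "j < k" "u $ j \<noteq> 0"
    using u by (metis carrier_vecD eq_vecI index_zero_vec)
  \<comment> \<open>A linear section of that map: only column \<open>j\<close> is nonzero, and
    dividing by \<open>u $ j\<close> makes \<open>E v\<close> send \<open>u\<close> to
    \<open>v\<close>.\<close>
  define E where "E = (\<lambda>v::'a vec. mat N k (\<lambda>(i, l). if l = j then v $ i / u $ j else 0))"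
  have E: "E v \<in> carrier_mat N k" for v by (simp add: E_def)
  have Eu: "E v *\<^sub>v u = v" if "v \<in> carrier_vec N" for v
  proof (rule eq_vecI)
    show "dim_vec (E v *\<^sub>v u) = dim_vec v" using that by (simp add: E_def)
    fix i assume i: "i < dim_vec v"
    then have "(E v *\<^sub>v u) $ i = (\<Sum>l<k. (if l = j then v $ i / u $ j else 0) * u $ l)"
      using that u by (auto simp: E_def scalar_prod_def atLeast0LessThan intro!: sum.cong)
    also have "\<dots> = (\<Sum>l<k. if l = j then v $ i else 0)"
      using j by (intro sum.cong) auto
    also have "\<dots> = v $ i" using j by simp
    finally show "(E v *\<^sub>v u) $ i = v $ i" .
  qed
  let ?K = "{L \<in> carrier_mat N k. L *\<^sub>v u = 0\<^sub>v N}"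
  \<comment> \<open>Proved for every target set, since it is needed both for the given
    \<open>S\<close> and for the whole space; the latter case expresses the number of all matrices
    through \<open>card ?K\<close>.\<close>
  have fib: "card {L \<in> carrier_mat N k. L *\<^sub>v u \<in> S} = card S * card ?K"
    if S: "S \<subseteq> carrier_vec N" for S
  proof -
    have add: "(L + E v) *\<^sub>v u = v" if "v \<in> S" "L \<in> ?K" for v L
    proof -
      have v: "v \<in> carrier_vec N" using that S by auto
      have "(L + E v) *\<^sub>v u = L *\<^sub>v u + E v *\<^sub>v u"
        using that u E by (intro add_mult_distrib_mat_vec) auto
      then show ?thesis using v that by (simp add: Eu)
    qed
    \<comment> \<open>Each matrix splits uniquely into an element of \<open>?K\<close> and some
      \<open>E v\<close>, where \<open>v\<close> must be its value at \<open>u\<close>.\<close>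
    have "bij_betw (\<lambda>(v, L). L + E v) (S \<times> ?K) {L \<in> carrier_mat N k. L *\<^sub>v u \<in> S}"
    proof (rule bij_betw_byWitness[where f' = "\<lambda>L. (L *\<^sub>v u, L - E (L *\<^sub>v u))"])
      show "\<forall>p\<in>S \<times> ?K. (\<lambda>L. (L *\<^sub>v u, L - E (L *\<^sub>v u))) ((\<lambda>(v, L). L + E v) p) = p"
      proof
        fix p assume "p \<in> S \<times> ?K"
        then obtain v L where p: "p = (v, L)" "v \<in> S" "L \<in> ?K" by auto
        then have "L + E v - E v = L" using E[of v] by (intro eq_matI) auto
        then show "(\<lambda>L. (L *\<^sub>v u, L - E (L *\<^sub>v u))) ((\<lambda>(v, L). L + E v) p) = p"
          using p add by simp
      qed
      show "\<forall>L\<in>{L \<in> carrier_mat N k. L *\<^sub>v u \<in> S}.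
          (\<lambda>(v, L). L + E v) (L *\<^sub>v u, L - E (L *\<^sub>v u)) = L"
      proof
        fix L assume "L \<in> {L \<in> carrier_mat N k. L *\<^sub>v u \<in> S}"
        then show "(\<lambda>(v, L). L + E v) (L *\<^sub>v u, L - E (L *\<^sub>v u)) = L"
          using E[of "L *\<^sub>v u"] by auto
      qed
      show "(\<lambda>(v, L). L + E v) ` (S \<times> ?K) \<subseteq> {L \<in> carrier_mat N k. L *\<^sub>v u \<in> S}"
        using add E by auto
      show "(\<lambda>L. (L *\<^sub>v u, L - E (L *\<^sub>v u))) ` {L \<in> carrier_mat N k. L *\<^sub>v u \<in> S} \<subseteq> S \<times> ?K"
      proof clarsimp
        fix L assume L: "L \<in> carrier_mat N k" "L *\<^sub>v u \<in> S"
        then have "(L - E (L *\<^sub>v u)) *\<^sub>v u = L *\<^sub>v u - E (L *\<^sub>v u) *\<^sub>v u"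
          using u E by (intro minus_mult_distrib_mat_vec) auto
        also have "\<dots> = 0\<^sub>v N" using L S by (subst Eu) auto
        finally show "L - E (L *\<^sub>v u) \<in> carrier_mat N k \<and> (L - E (L *\<^sub>v u)) *\<^sub>v u = 0\<^sub>v N"
          using L E[of "L *\<^sub>v u"] by (auto intro: minus_carrier_mat)
      qed
    qed
    from bij_betw_same_card[OF this] show ?thesis by (simp add: card_cartesian_product)
  qed
  have "{L \<in> carrier_mat N k. L *\<^sub>v u \<in> carrier_vec N} = carrier_mat N k"
    using u by auto
  then have "card (carrier_mat N k :: 'a mat set) = CARD('a) ^ N * card ?K"
    using fib[of "carrier_vec N"] by (simp add: card_carrier_vec)
  then show ?thesis using fib[OF S] by simp
qed

section \<open>Decoding from separation of message differences\<close>

text \<open>Here \<open>y - z = b - a\<close>, whose support lies in the union of the supports of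
  \<open>a\<close> and \<open>b\<close>. In the application \<open>a\<close> and \<open>b\<close>
  are two error vectors explaining the same received word.\<close>

lemma hamming_weight_le_of_add_eq:
  fixes a b y z :: "'a::ab_group_add vec"
  assumes "a \<in> carrier_vec N" "b \<in> carrier_vec N" "y \<in> carrier_vec N" "z \<in> carrier_vec N"
    and eq: "y + a = z + b"
  shows "hamming_weight (y - z) \<le> hamming_weight a + hamming_weight b"
proof -
  have "(y - z) $ i = b $ i - a $ i" if "i < N" for i
    using arg_cong[OF eq, of "\<lambda>v. v $ i"] that assms(1-4) by (simp add: algebra_simps)
  then have "{i. i < N \<and> (y - z) $ i \<noteq> 0} \<subseteq> {i. i < N \<and> a $ i \<noteq> 0} \<union> {i. i < N \<and> b $ i \<noteq> 0}"
    by auto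
  from card_mono[OF _ this] have "card {i. i < N \<and> (y - z) $ i \<noteq> 0}
      \<le> card ({i. i < N \<and> a $ i \<noteq> 0} \<union> {i. i < N \<and> b $ i \<noteq> 0})" by simp
  also have "\<dots> \<le> card {i. i < N \<and> a $ i \<noteq> 0} + card {i. i < N \<and> b $ i \<noteq> 0}"
    by (rule card_Un_le)
  finally show ?thesis using assms(1-4) by (simp add: hamming_weight_def)
qed

text \<open>Suppose two messages explain the same received word and side information but differ in
  the requested value. Their difference \<open>Z\<close> meets the premises of \<open>sep\<close>,
  yet its encoding is a difference of two errors and has weight at most
  \<open>2 * \<delta>\<close>.\<close>

lemma represents_ecicI:
  fixes L VS R :: "'a::field mat"
  assumes L: "L \<in> carrier_mat N dS" and VS: "VS \<in> carrier_mat dS n"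
    and V: "\<And>i. i < m \<Longrightarrow> V i \<in> carrier_mat (d i) n" and R: "R \<in> carrier_mat m n"
    and sep: "\<And>i Z. i < m \<Longrightarrow> Z \<in> carrier_vec n \<Longrightarrow> V i *\<^sub>v Z = 0\<^sub>v (d i) \<Longrightarrow> row R i \<bullet> Z \<noteq> 0
      \<Longrightarrow> 2 * \<delta> < hamming_weight (L *\<^sub>v (VS *\<^sub>v Z))"
  shows "represents_ecic m n dS VS \<delta> V R N L"
  unfolding represents_ecic_def
proof (intro conjI L allI impI)
  fix i assume i: "i < m"
  \<comment> \<open>The messages \<open>X\<close> that can produce the pair \<open>p\<close> of
    received word and side information with at most \<open>\<delta>\<close> errors.\<close>
  define consistent where "consistent = (\<lambda>p X. X \<in> carrier_vec n \<and>
    (\<exists>W\<in>carrier_vec N. hamming_weight W \<le> \<delta> \<and> p = (L * VS *\<^sub>v X + W, V i *\<^sub>v X)))"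
  have unique: "row R i \<bullet> X = row R i \<bullet> X'" if "consistent p X" "consistent p X'" for p X X'
  proof (rule ccontr)
    assume neq: "row R i \<bullet> X \<noteq> row R i \<bullet> X'"
    obtain W W' where W: "X \<in> carrier_vec n" "X' \<in> carrier_vec n"
        "W \<in> carrier_vec N" "W' \<in> carrier_vec N"
        "hamming_weight W \<le> \<delta>" "hamming_weight W' \<le> \<delta>"
        "L * VS *\<^sub>v X + W = L * VS *\<^sub>v X' + W'" "V i *\<^sub>v X = V i *\<^sub>v X'"
      using \<open>consistent p X\<close> \<open>consistent p X'\<close> unfolding consistent_def by auto
    have LV: "L * VS \<in> carrier_mat N n" using L VS by simp
    have "V i *\<^sub>v (X - X') = V i *\<^sub>v X - V i *\<^sub>v X'"
      using V[OF i] W by (intro mult_minus_distrib_mat_vec) auto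
    also have "\<dots> = 0\<^sub>v (d i)" using V[OF i] W by auto
    finally have 1: "V i *\<^sub>v (X - X') = 0\<^sub>v (d i)" .
    have "row R i \<in> carrier_vec n" using R i by auto
    then have 2: "row R i \<bullet> (X - X') \<noteq> 0"
      using neq W by (simp add: scalar_prod_minus_distrib)
    have "L *\<^sub>v (VS *\<^sub>v (X - X')) = L * VS *\<^sub>v (X - X')"
      using assoc_mult_mat_vec[OF L VS] W by simp
    also have "\<dots> = L * VS *\<^sub>v X - L * VS *\<^sub>v X'"
      using LV W by (intro mult_minus_distrib_mat_vec) auto
    finally have "hamming_weight (L *\<^sub>v (VS *\<^sub>v (X - X'))) \<le> hamming_weight W + hamming_weight W'"
      using hamming_weight_le_of_add_eq[OF W(3,4) _ _ W(7)] LV W by auto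
    then show False using sep[OF i _ 1 2] W by simp
  qed
  show "\<exists>D. \<forall>X\<in>carrier_vec n. \<forall>W\<in>carrier_vec N. hamming_weight W \<le> \<delta> \<longrightarrow>
      D (L * VS *\<^sub>v X + W, V i *\<^sub>v X) = row R i \<bullet> X"
  proof (intro exI ballI impI)
    fix X W :: "'a vec" assume "X \<in> carrier_vec n" "W \<in> carrier_vec N" "hamming_weight W \<le> \<delta>"
    then have c: "consistent (L * VS *\<^sub>v X + W, V i *\<^sub>v X) X"
      unfolding consistent_def by auto
    \<comment> \<open>The decoder evaluates the request on an arbitrary consistent message; by
      \<open>unique\<close> the choice does not affect the result. Pairs without a consistent
      message get an arbitrary value.\<close>
    then show "(\<lambda>p. row R i \<bullet> (SOME X. consistent p X)) (L * VS *\<^sub>v X + W, V i *\<^sub>v X) = row R i \<bullet> X"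
      using unique[OF someI[of "consistent _", OF c] c] by simp
  qed
qed

text \<open>Write \<open>w\<close> as \<open>G\<^sup>T *\<^sub>v y\<close> and move the transpose to
  the other factor. For \<open>VS\<close> this shows that requests vanish wherever the encoding
  input does; for \<open>V i\<close> it places kernel vectors in the annihilator of
  \<open>X i\<close>.\<close>

lemma row_space_orthogonal_kernel:
  fixes G :: "'a::field mat"
  assumes G: "G \<in> carrier_mat k n" and w: "w \<in> vec_space.row_space n G"
    and Z: "Z \<in> carrier_vec n" "G *\<^sub>v Z = 0\<^sub>v k"
  shows "w \<bullet> Z = 0"
proof -
  obtain y where y: "y \<in> carrier_vec k" "G\<^sup>T *\<^sub>v y = w"
    using w G unfolding vec_space.row_space_eq[OF G] by auto
  then have "w \<bullet> Z = y \<bullet> (G *\<^sub>v Z)"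
    using transpose_vec_mult_scalar[OF G Z(1) y(1)] by simp
  then show ?thesis using Z y by simp
qed

section \<open>Union bound over receivers and message differences\<close>

theorem mainTheorem10:
  fixes m n dS \<delta> N :: nat
    and X :: "nat \<Rightarrow> 'a::{field,finite} vec set"
    and d :: "nat \<Rightarrow> nat"
    and XS :: "'a vec set"
    and R VS :: "'a mat"
    and V :: "nat \<Rightarrow> 'a mat"
  assumes "iccsi_instance m n X d XS dS R"
    and "generator_matrix n XS dS VS"
    and "\<And>i. i < m \<Longrightarrow> generator_matrix n (X i) (d i) (V i)"
    and "0 < N"
  shows "measure_pmf.prob (pmf_of_set (carrier_mat N dS)) {L. represents_ecic m n dS VS \<delta> V R N L}
           \<ge> 1 - (\<Sum>i<m. real CARD('a) powi (int n - int (d i) - 1) * (real CARD('a) - 1)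
                   * (real (hamming_ball_card TYPE('a) N (2 * \<delta>)) / real CARD('a) ^ N))
       \<and> (real N > real n - real (Min (d ` {..<m})) - 1
           + log (real CARD('a)) (real m * (real CARD('a) - 1)
                   * real (hamming_ball_card TYPE('a) N (2 * \<delta>)))
         \<longrightarrow> (\<exists>L \<in> carrier_mat N dS. represents_ecic m n dS VS \<delta> V R N L))"
proof -
  let ?q = "real CARD('a)" and ?v = "real (hamming_ball_card TYPE('a) N (2 * \<delta>))"
  let ?M = "carrier_mat N dS :: 'a mat set"
  let ?good = "{L. represents_ecic m n dS VS \<delta> V R N L}"
  let ?e = "\<lambda>i. ?q powi (int n - int (d i) - 1) * (?q - 1) * (?v / ?q ^ N)"
  have q: "?q > 1"
    using one_less_card_UNIV[where 'a = 'a] by simp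
  have fM: "finite ?M" by (rule finite_carrier_mat)
  have neM: "?M \<noteq> {}" using zero_carrier_mat by blast
  have cM: "card ?M > 0" using fM neM by (simp add: card_gt_0_iff)
  have m: "0 < m" and R: "R \<in> carrier_mat m n"
    and Xd: "\<And>i. i < m \<Longrightarrow> is_subspace_of_dim n (X i) (d i)"
    and RS: "\<And>i. i < m \<Longrightarrow> row R i \<in> XS"
    using assms(1) by (auto simp: iccsi_instance_def)
  have VS: "VS \<in> carrier_mat dS n" "vec_space.row_space n VS = XS"
    using assms(2) by (auto simp: generator_matrix_def)
  have V: "V i \<in> carrier_mat (d i) n" "vec_space.row_space n (V i) = X i" if "i < m" for i
    using assms(3)[OF that] by (auto simp: generator_matrix_def)
  \<comment> \<open>\<open>Z i\<close> consists of the message differences that receiver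
    \<open>i\<close> must tell apart from zero, and \<open>B z\<close> of the matrices that encode
    \<open>z\<close> with weight too small for this.\<close>
  define Z where "Z = (\<lambda>i. {z \<in> annihilator n (X i). row R i \<bullet> z \<noteq> 0})"
  define S where "S = {w \<in> (carrier_vec N :: 'a vec set). hamming_weight w \<le> 2 * \<delta>}"
  define B where "B = (\<lambda>z. {L \<in> ?M. L *\<^sub>v (VS *\<^sub>v z) \<in> S})"
  have fZ: "finite (Z i)" for i
    by (rule finite_subset[OF _ finite_carrier_vec[of n]]) (auto simp: Z_def annihilator_def)
  have v: "?v = card S" by (simp add: S_def hamming_ball_card_def)
  have cB: "card (B z) = card ?M * (?v / ?q ^ N)" if "i < m" "z \<in> Z i" for i z
  proof -
    have z: "z \<in> carrier_vec n" "row R i \<bullet> z \<noteq> 0"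
      using that by (auto simp: Z_def annihilator_def)
    \<comment> \<open>Membership of the requested row in \<open>XS\<close> enters here: if
      \<open>VS\<close> killed \<open>z\<close>, so would that row.\<close>
    then have "VS *\<^sub>v z \<noteq> 0\<^sub>v dS"
      using row_space_orthogonal_kernel[OF VS(1), of "row R i" z] VS(2) RS that by auto
    then have "card (B z) * CARD('a) ^ N = card S * card ?M"
      unfolding B_def using VS z by (intro card_matrices_mapping_into) (auto simp: S_def)
    then have "card (B z) * ?q ^ N = ?v * card ?M"
      unfolding v by (metis of_nat_mult of_nat_power)
    then show ?thesis using q by (simp add: field_simps)
  qed
  have cover: "?M - ?good \<subseteq> (\<Union>i<m. \<Union>z\<in>Z i. B z)"
  proof
    fix L assume L: "L \<in> ?M - ?good"
    \<comment> \<open>Contrapositive of \<open>represents_ecicI\<close>: a matrix that fails must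
      have a low-weight difference for some receiver.\<close>
    have "\<exists>i z. i < m \<and> z \<in> carrier_vec n \<and> V i *\<^sub>v z = 0\<^sub>v (d i) \<and> row R i \<bullet> z \<noteq> 0
      \<and> hamming_weight (L *\<^sub>v (VS *\<^sub>v z)) \<le> 2 * \<delta>"
    proof (rule ccontr)
      assume none: "\<not> ?thesis"
      have "represents_ecic m n dS VS \<delta> V R N L"
      proof (rule represents_ecicI[of L N dS VS n m V d R \<delta>])
        show "2 * \<delta> < hamming_weight (L *\<^sub>v (VS *\<^sub>v z))"
          if "i < m" "z \<in> carrier_vec n" "V i *\<^sub>v z = 0\<^sub>v (d i)" "row R i \<bullet> z \<noteq> 0" for i z
          using none that not_less by blast
      qed (use L VS V R in auto)
      then show False using L by simp
    qed
    then obtain i z where iz: "i < m" "z \<in> carrier_vec n" "V i *\<^sub>v z = 0\<^sub>v (d i)" "row R i \<bullet> z \<noteq> 0"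
        "hamming_weight (L *\<^sub>v (VS *\<^sub>v z)) \<le> 2 * \<delta>"
      by blast
    then have "z \<in> Z i"
      using row_space_orthogonal_kernel[OF V(1)] V(2) by (auto simp: Z_def annihilator_def)
    moreover have "L \<in> B z"
      using L iz VS by (auto simp: B_def S_def)
    ultimately show "L \<in> (\<Union>i<m. \<Union>z\<in>Z i. B z)" using iz by blast
  qed
  have fB: "finite (B z)" for z unfolding B_def using fM by simp
  have "real (card (?M - ?good)) \<le> real (card (\<Union>i<m. \<Union>z\<in>Z i. B z))"
    using cover fZ fB by (intro of_nat_mono card_mono) auto
  also have "\<dots> \<le> real (\<Sum>i<m. \<Sum>z\<in>Z i. card (B z))"
    by (intro of_nat_mono order_trans[OF card_UN_le] sum_mono card_UN_le fZ) auto
  also have "\<dots> = (\<Sum>i<m. real (card (Z i)) * (card ?M * (?v / ?q ^ N)))"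
    by (simp add: cB)
  \<comment> \<open>All \<open>B z\<close> have the same size, so only the number of elements of
    each \<open>Z i\<close> remains to be bounded.\<close>
  also have "\<dots> \<le> (\<Sum>i<m. ?q powi (int n - int (d i) - 1) * (?q - 1) * (card ?M * (?v / ?q ^ N)))"
    unfolding Z_def using Xd R
    by (intro sum_mono mult_right_mono card_annihilator_nonorthogonal_le) auto
  also have "\<dots> = card ?M * (\<Sum>i<m. ?e i)"
    by (simp add: sum_distrib_left mult_ac)
  finally have bad: "real (card (?M - ?good)) \<le> card ?M * (\<Sum>i<m. ?e i)" .
  have "card (?M \<inter> ?good) + card (?M - ?good) = card ?M"
    using card_Int_Diff[OF fM] by metis
  then have "real (card (?M \<inter> ?good)) = card ?M - real (card (?M - ?good))"
    by linarith
  then have "(1 - (\<Sum>i<m. ?e i)) * card ?M \<le> real (card (?M \<inter> ?good))"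
    using bad by (simp only: left_diff_distrib mult.commute[of "sum _ _"])
  then have "real (card (?M \<inter> ?good)) / card ?M \<ge> 1 - (\<Sum>i<m. ?e i)"
    using cM by (subst pos_le_divide_eq) auto
  then have prob: "measure_pmf.prob (pmf_of_set ?M) ?good \<ge> 1 - (\<Sum>i<m. ?e i)"
    by (simp add: measure_pmf_of_set[OF neM fM])
  have "\<exists>L\<in>?M. represents_ecic m n dS VS \<delta> V R N L"
    if N: "real N > real n - real (Min (d ` {..<m})) - 1 + log ?q (real m * (?q - 1) * ?v)"
  proof (rule ccontr)
    assume "\<not> (\<exists>L\<in>?M. represents_ecic m n dS VS \<delta> V R N L)"
    then have "?M \<inter> ?good = {}" by blast
    \<comment> \<open>Without a representing matrix the probability is 0, so the estimate forces the
      error sum up to at least 1.\<close>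
    then have "1 \<le> (\<Sum>i<m. ?e i)"
      using prob by (simp add: measure_pmf_of_set[OF neM fM])
    \<comment> \<open>Replacing each \<open>d i\<close> by the minimum only raises the exponent, and
      \<open>?q > 1\<close>.\<close>
    also have "\<dots> \<le> (\<Sum>i<m. ?q powi (int n - int (Min (d ` {..<m})) - 1) * (?q - 1) * (?v / ?q ^ N))"
    proof (intro sum_mono mult_right_mono)
      fix i assume "i \<in> {..<m}"
      then have "Min (d ` {..<m}) \<le> d i" by simp
      then show "?q powi (int n - int (d i) - 1) \<le> ?q powi (int n - int (Min (d ` {..<m})) - 1)"
        using q by (intro power_int_increasing) auto
    qed (use q in auto)
    also have "\<dots> = (real m * (?q - 1) * ?v)
        * (?q powr (real n - real (Min (d ` {..<m})) - 1) / ?q powr N)"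
      using q by (simp add: powr_real_of_int'[symmetric] powr_realpow)
    finally have ge: "1 \<le> (real m * (?q - 1) * ?v)
        * (?q powr (real n - real (Min (d ` {..<m})) - 1) / ?q powr N)" (is "_ \<le> ?c * _") .
    \<comment> \<open>Read off from \<open>ge\<close>, whose right side would otherwise be 0. It
      makes \<open>?c\<close> positive, so that \<open>?c\<close> is \<open>?q\<close> raised to its
      logarithm.\<close>
    have "?v \<noteq> 0"
    proof
      assume v0: "?v = 0"
      show False using ge unfolding v0 by simp
    qed
    then have c: "?c > 0" using q m by simp
    have "?c * (?q powr (real n - real (Min (d ` {..<m})) - 1) / ?q powr N)
        = ?q powr (log ?q ?c + (real n - real (Min (d ` {..<m})) - 1) - N)"
      using c q by (simp add: powr_add powr_diff)
    \<comment> \<open>The hypothesis on \<open>N\<close> says exactly that this exponent is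
      negative.\<close>
    also have "\<dots> < ?q powr 0" using N q by (intro powr_less_mono) auto
    also have "?q powr 0 = 1" using q by simp
    finally show False using ge by linarith
  qed
  with prob show ?thesis by blast
qed

end
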